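(* Let $D, M \ge 1$, let $B_j \in \mathbb{R}^{M\times D}$ with rows $b_{j,1}^\top,\dots,b_{j,M}^\top$, and let $t_j \in \mathbb{R}^D$. Let $R_j \in \mathbb{R}^{D\times r}$ be a matrix whose columns form an orthonormal basis of the subspace $\mathrm{span}\{b_{j,1},\dots,b_{j,M}\} \subseteq \mathbb{R}^D$, and define $$t_j^\perp = (I_D - R_j R_j^\top)\, t_j .$$ For $\gamma > 0$ define the CARE direction $$d_j(\gamma) = \left(\tfrac{1}{M} B_j^\top B_j + \gamma I_D\right)^{-1} t_j .$$ If $t_j^\perp \neq 0$, then as $\gamma \to 0^+$ the direction $d_j(\gamma)$ becomes equivalent, up to scale, to $t_j^\perp$; that is, $$\lim_{\gamma \to 0^+} \frac{d_j(\gamma)}{\|d_j(\gamma)\|} = \frac{t_j^\perp}{\|t_j^\perp\|} .$$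
   Context: $\|\cdot\|$ is the Euclidean norm on $\mathbb{R}^D$ and $I_D$ the $D\times D$ identity matrix. The vectors $b_{j,m}$ are called retained anchors and $t_j$ the target value vector; the subscript $j$ is a fixed index and plays no role. *)

theory Defs
  imports "HOL-Analysis.Analysis"
begin

text \<open>
  A real matrix with \<open>r\<close> columns is given by its columns \<open>R 0, \<dots>, R (r - 1)\<close>; the values
  \<open>R k\<close> for \<open>k \<ge> r\<close> are irrelevant. Taking \<open>r\<close> to be a natural number rather than the
  cardinality of an index type admits \<open>r = 0\<close>, the case where the spanned subspace is trivial.
\<close>

definition orthonormal_basis_columns ::
    "nat \<Rightarrow> (nat \<Rightarrow> 'a::euclidean_space) \<Rightarrow> 'a set \<Rightarrow> bool" where
  "orthonormal_basis_columns r R S \<longleftrightarrow>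
     (\<forall>k<r. \<forall>l<r. R k \<bullet> R l = (if k = l then 1 else 0)) \<and> span (R ` {..<r}) = S"

text \<open>The product of the matrix with its transpose, entrywise.\<close>

definition columns_mult_transpose :: "nat \<Rightarrow> (nat \<Rightarrow> real ^ 'd) \<Rightarrow> real ^ 'd ^ 'd" where
  "columns_mult_transpose r R = (\<chi> i j. \<Sum>k<r. R k $ i * R k $ j)"

definition perp_component :: "nat \<Rightarrow> (nat \<Rightarrow> real ^ 'd) \<Rightarrow> real ^ 'd \<Rightarrow> real ^ 'd" where
  "perp_component r R t = (mat 1 - columns_mult_transpose r R) *v t"

text \<open>For \<open>\<gamma> > 0\<close> the matrix below is positive definite, so \<^const>\<open>matrix_inv\<close> is its inverse.\<close>

definition care_direction :: "real ^ 'd ^ 'm \<Rightarrow> real ^ 'd \<Rightarrow> real \<Rightarrow> real ^ 'd" where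
  "care_direction B t \<gamma> =
     matrix_inv ((1 / real CARD('m)) *\<^sub>R (transpose B ** B) + \<gamma> *\<^sub>R mat 1) *v t"

end

theory Submission
  imports Defs
begin

text \<open>
  Write \<open>t = p + B\<^sup>T v\<close> with \<open>p\<close> the orthogonal component of \<open>t\<close>, so that \<open>B p = 0\<close>. The error
  \<open>e = \<gamma> d(\<gamma>) - p\<close> then solves \<open>(c B\<^sup>T B + \<gamma> I) e = \<gamma> B\<^sup>T v\<close> with \<open>c = 1 / M\<close>. Pairing this with \<open>e\<close>
  and applying AM-GM gives \<open>4 c \<parallel>e\<parallel>\<^sup>2 \<le> \<gamma> \<parallel>v\<parallel>\<^sup>2\<close>. Hence \<open>\<gamma> d(\<gamma>)\<close> tends to \<open>p\<close>, and normalisation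
  removes the positive factor \<open>\<gamma>\<close>.
\<close>

lemma mult_matrix_inv:
  fixes A :: "'a::semiring_1 ^ 'n ^ 'm"
  assumes "invertible A"
  shows "A ** matrix_inv A = mat 1"
  using someI_ex[OF assms[unfolded invertible_def]] by (simp add: matrix_inv_def)

lemma inner_vector_matrix_mult:
  fixes B :: "real ^ 'n ^ 'm"
  shows "x \<bullet> (v v* B) = (B *v x) \<bullet> v"
  by (metis dot_lmul_matrix inner_commute)

text \<open>Each row is the image of a standard basis vector under the transpose of
  \<open>B\<close>. This turns membership in the row space into an explicit preimage
  \<open>v\<close>, on which the error estimate depends.\<close>

lemma span_rows_eq_range_vector_matrix_mult:
  fixes B :: "real ^ 'n ^ 'm"
  shows "span (rows B) = range (\<lambda>v. v v* B)"
proof (rule span_unique)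
  show "rows B \<subseteq> range (\<lambda>v. v v* B)"
  proof
    fix x assume "x \<in> rows B"
    then obtain i where "x = column i (transpose B)"
      by (auto simp: rows_def row_def column_def transpose_def)
    then show "x \<in> range (\<lambda>v. v v* B)"
      by (metis matrix_vector_mult_basis rangeI transpose_matrix_vector)
  qed
  show "subspace (range (\<lambda>v. v v* B))"
    using linear_subspace_image[OF matrix_vector_mul_linear subspace_UNIV, of "transpose B"]
    by simp
  show "range (\<lambda>v. v v* B) \<subseteq> T" if "rows B \<subseteq> T" "subspace T" for T
    using matrix_vector_mult_in_columnspace[of "transpose B"] span_minimal[OF that] by auto
qed

lemma regularized_gram_mult_vector:
  fixes B :: "real ^ 'n ^ 'm"
  shows "(c *\<^sub>R (transpose B ** B) + \<gamma> *\<^sub>R mat 1) *v x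
    = c *\<^sub>R ((B *v x) v* B) + \<gamma> *\<^sub>R x"
  by (simp add: matrix_vector_mult_add_rdistrib flip: matrix_vector_mul_assoc scaleR_matrix_vector_assoc)

lemma inner_regularized_gram:
  fixes B :: "real ^ 'n ^ 'm"
  shows "x \<bullet> ((c *\<^sub>R (transpose B ** B) + \<gamma> *\<^sub>R mat 1) *v x)
    = c * (norm (B *v x))\<^sup>2 + \<gamma> * (norm x)\<^sup>2"
  by (simp add: regularized_gram_mult_vector inner_add_right inner_vector_matrix_mult
      power2_norm_eq_inner)

text \<open>The quadratic form of the matrix at \<open>x\<close> is at least
  \<open>\<gamma> * (norm x)\<^sup>2\<close>, so the kernel is trivial.\<close>

lemma invertible_regularized_gram:
  fixes B :: "real ^ 'n ^ 'm"
  assumes "c \<ge> 0" "\<gamma> > 0"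
  shows "invertible (c *\<^sub>R (transpose B ** B) + \<gamma> *\<^sub>R mat 1)"
proof -
  have "x = 0" if "(c *\<^sub>R (transpose B ** B) + \<gamma> *\<^sub>R mat 1) *v x = 0" for x
  proof -
    have "c * (norm (B *v x))\<^sup>2 + \<gamma> * (norm x)\<^sup>2 = 0"
      using inner_regularized_gram[of x c B \<gamma>] that by simp
    moreover have "c * (norm (B *v x))\<^sup>2 \<ge> 0" "\<gamma> * (norm x)\<^sup>2 \<ge> 0"
      using assms by simp_all
    ultimately have "\<gamma> * (norm x)\<^sup>2 = 0"
      by linarith
    then show "x = 0"
      using assms by simp
  qed
  then show ?thesis
    by (simp add: invertible_left_inverse matrix_left_invertible_ker)
qed

text \<open>Since the right-hand side lies in the row space, its pairing with \<open>e\<close>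
  involves only \<open>B *v e\<close>, which the Gram term controls; no eigenvalue of the Gram
  matrix enters the bound.\<close>

lemma regularized_gram_solution_bound:
  fixes B :: "real ^ 'n ^ 'm"
  assumes "c > 0" "\<gamma> > 0"
    and eq: "(c *\<^sub>R (transpose B ** B) + \<gamma> *\<^sub>R mat 1) *v e = \<gamma> *\<^sub>R (v v* B)"
  shows "4 * c * (norm e)\<^sup>2 \<le> \<gamma> * (norm v)\<^sup>2"
proof -
  let ?a = "norm (B *v e)" and ?b = "norm v"
  have "c * ?a\<^sup>2 + \<gamma> * (norm e)\<^sup>2 = \<gamma> * ((B *v e) \<bullet> v)"
    using inner_regularized_gram[of e c B \<gamma>] by (simp add: eq inner_vector_matrix_mult)
  also have "\<dots> \<le> \<gamma> * (?a * ?b)"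
    using assms norm_cauchy_schwarz[of "B *v e" v] by simp
  finally have "4 * c * (c * ?a\<^sup>2 + \<gamma> * (norm e)\<^sup>2) \<le> 4 * c * (\<gamma> * (?a * ?b))"
    using assms by (intro mult_left_mono) auto
  \<comment> \<open>Expanding this square bounds the cross term by
    \<open>4 * c\<^sup>2 * ?a\<^sup>2 + \<gamma>\<^sup>2 * ?b\<^sup>2\<close>; the factor
    \<open>4 * c\<close> above makes the terms in \<open>?a\<^sup>2\<close> cancel.\<close>
  moreover have "0 \<le> (2 * c * ?a - \<gamma> * ?b)\<^sup>2"
    by simp
  ultimately have "\<gamma> * (4 * c * (norm e)\<^sup>2) \<le> \<gamma> * (\<gamma> * ?b\<^sup>2)"
    by (simp add: power2_eq_square algebra_simps)
  then show ?thesis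
    using assms by simp
qed

lemma perp_component_eq:
  "perp_component r R t = t - (\<Sum>k<r. (R k \<bullet> t) *\<^sub>R R k)"
proof -
  have "columns_mult_transpose r R *v t = (\<Sum>k<r. (R k \<bullet> t) *\<^sub>R R k)"
    by (simp add: vec_eq_iff columns_mult_transpose_def matrix_vector_mult_def inner_vec_def
        sum_distrib_right sum_distrib_left sum.swap[of _ "{..<r}"] mult_ac)
  then show ?thesis
    by (simp add: perp_component_def matrix_vector_mult_diff_rdistrib)
qed

lemma perp_component_diff_in_span:
  assumes "orthonormal_basis_columns r R S"
  shows "t - perp_component r R t \<in> S"
proof -
  have "(\<Sum>k<r. (R k \<bullet> t) *\<^sub>R R k) \<in> span (R ` {..<r})"
    by (intro span_sum span_scale span_base) auto
  then show ?thesis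
    using assms by (simp add: perp_component_eq orthonormal_basis_columns_def)
qed

text \<open>By linearity it suffices to test against the columns of \<open>R\<close>, where
  orthonormality leaves a single term of the expansion.\<close>

lemma perp_component_orthogonal:
  assumes "orthonormal_basis_columns r R S" "x \<in> S"
  shows "orthogonal (perp_component r R t) x"
proof (rule orthogonal_to_span)
  show "x \<in> span (R ` {..<r})"
    using assms by (simp add: orthonormal_basis_columns_def)
  fix y assume "y \<in> R ` {..<r}"
  then obtain l where l: "l < r" "y = R l"
    by auto
  have "(\<Sum>k<r. (R k \<bullet> t) *\<^sub>R R k) \<bullet> R l = (\<Sum>k<r. if k = l then R k \<bullet> t else 0)"
    unfolding inner_sum_left using assms(1) l(1)
    by (intro sum.cong) (auto simp: orthonormal_basis_columns_def)
  also have "\<dots> = R l \<bullet> t"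
    using l(1) by simp
  finally show "orthogonal (perp_component r R t) y"
    by (simp add: perp_component_eq l(2) orthogonal_def inner_diff_left
        inner_commute[of t])
qed

theorem proposition3:
  fixes B :: "real ^ 'd ^ 'm"
    and t :: "real ^ 'd"
    and R :: "nat \<Rightarrow> real ^ 'd"
    and r :: nat
  assumes "orthonormal_basis_columns r R (span (rows B))"
    and "perp_component r R t \<noteq> 0"
  shows "((\<lambda>\<gamma>. care_direction B t \<gamma> /\<^sub>R norm (care_direction B t \<gamma>))
           \<longlongrightarrow> perp_component r R t /\<^sub>R norm (perp_component r R t)) (at_right 0)"
proof -
  define p where "p = perp_component r R t"
  define c where "c = 1 / real CARD('m)"
  let ?G = "\<lambda>\<gamma>. c *\<^sub>R (transpose B ** B) + \<gamma> *\<^sub>R mat 1 :: real ^ 'd ^ 'd"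
  let ?d = "care_direction B t"
  have "c > 0"
    by (simp add: c_def)
  obtain v where v: "t - p = v v* B"
    using perp_component_diff_in_span[OF assms(1), of t]
    by (auto simp: p_def span_rows_eq_range_vector_matrix_mult)
  \<comment> \<open>Testing the orthogonality of \<open>p\<close> on this particular vector gives
    \<open>(B *v p) \<bullet> (B *v p) = 0\<close>.\<close>
  have "(B *v p) v* B \<in> span (rows B)"
    by (simp add: span_rows_eq_range_vector_matrix_mult)
  then have "p \<bullet> ((B *v p) v* B) = 0"
    using perp_component_orthogonal[OF assms(1)] by (simp add: p_def orthogonal_def)
  then have Bp: "B *v p = 0"
    by (simp add: inner_vector_matrix_mult)
  have bound: "norm (\<gamma> *\<^sub>R ?d \<gamma> - p) \<le> sqrt (\<gamma> * (norm v)\<^sup>2 / (4 * c))" if "\<gamma> > 0" for \<gamma>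
  proof -
    have "?G \<gamma> ** matrix_inv (?G \<gamma>) = mat 1"
      using invertible_regularized_gram[of c \<gamma> B] \<open>c > 0\<close> that
      by (simp add: mult_matrix_inv)
    then have "?G \<gamma> *v ?d \<gamma> = t"
      by (simp add: care_direction_def c_def matrix_vector_mul_assoc)
    \<comment> \<open>As \<open>B *v p = 0\<close>, the matrix acts on \<open>p\<close> as
      multiplication by \<open>\<gamma>\<close>.\<close>
    then have "?G \<gamma> *v (\<gamma> *\<^sub>R ?d \<gamma> - p) = \<gamma> *\<^sub>R t - \<gamma> *\<^sub>R p"
      using regularized_gram_mult_vector[of c B \<gamma> p]
      by (simp add: matrix_vector_mult_diff_distrib matrix_vector_mult_scaleR Bp)
    also have "\<dots> = \<gamma> *\<^sub>R (v v* B)"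
      by (simp flip: v add: scaleR_diff_right)
    finally have "4 * c * (norm (\<gamma> *\<^sub>R ?d \<gamma> - p))\<^sup>2 \<le> \<gamma> * (norm v)\<^sup>2"
      using regularized_gram_solution_bound \<open>c > 0\<close> that by blast
    then show ?thesis
      using \<open>c > 0\<close> by (intro real_le_rsqrt) (simp add: field_simps)
  qed
  have "((\<lambda>\<gamma>. \<gamma> *\<^sub>R ?d \<gamma> - p) \<longlongrightarrow> 0) (at_right 0)"
  proof (rule Lim_null_comparison)
    show "\<forall>\<^sub>F \<gamma> in at_right 0. norm (\<gamma> *\<^sub>R ?d \<gamma> - p) \<le> sqrt (\<gamma> * (norm v)\<^sup>2 / (4 * c))"
      using bound by (auto simp: eventually_at_right_less intro: eventually_at_rightI[of 0 1])
    show "((\<lambda>\<gamma>. sqrt (\<gamma> * (norm v)\<^sup>2 / (4 * c))) \<longlongrightarrow> 0) (at_right 0)"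
      using \<open>c > 0\<close> by (auto intro!: tendsto_eq_intros)
  qed
  then have "((\<lambda>\<gamma>. \<gamma> *\<^sub>R ?d \<gamma>) \<longlongrightarrow> p) (at_right 0)"
    by (simp add: LIM_zero_iff)
  then have "((\<lambda>\<gamma>. (\<gamma> *\<^sub>R ?d \<gamma>) /\<^sub>R norm (\<gamma> *\<^sub>R ?d \<gamma>)) \<longlongrightarrow> p /\<^sub>R norm p) (at_right 0)"
    using assms(2) by (intro tendsto_intros) (auto simp: p_def)
  \<comment> \<open>Where \<open>?d \<gamma>\<close> vanishes, both sides are 0 because
    \<open>inverse 0 = 0\<close>, so no case split is needed.\<close>
  moreover have "\<forall>\<^sub>F \<gamma> in at_right 0.
      (\<gamma> *\<^sub>R ?d \<gamma>) /\<^sub>R norm (\<gamma> *\<^sub>R ?d \<gamma>) = ?d \<gamma> /\<^sub>R norm (?d \<gamma>)"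
    by (rule eventually_at_rightI[of 0 1]) auto
  ultimately show ?thesis
    unfolding p_def by (rule Lim_transform_eventually)
qed

end
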